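(* Let $\mathbb F$ be a differential field with field of constants $\mathbb K$. If $M\in \mathbb F^{n,n}$ satisfies $MM' = M'M$ and is $\mathbb F$-diagonalizable, then $M$ is of Type 1.
   Context: A differential field $\mathbb F$ is an (algebraic) field together with an additional operation ${}'$ (the derivative) satisfying $(a+b)'=a'+b'$ and $(ab)'=ab'+a'b$ for all $a,b\in\mathbb F$. An element $a\in\mathbb F$ is a constant if $a'=0$; the constants form a subfield $\mathbb K$ of $\mathbb F$, called the field of constants. $\mathbb F^{n,n}$ denotes the $n\times n$ matrices over $\mathbb F$, and for $M=[m_{i,j}]\in\mathbb F^{n,n}$ the derivative $M'=[m_{i,j}']$ is taken entrywise. For a subfield $\mathbb H$ of $\mathbb F$, a matrix $M\in\mathbb F^{n,n}$ is $\mathbb H$-diagonalizable if there exists a nonsingular $T\in\mathbb H^{n,n}$ such that $T^{-1}MT$ is diagonal. A matrix $M\in\mathbb F^{n,n}$ is of Type 1 if $M=\sum_{j=1}^{k} f_j C_j$ for some $f_j\in\mathbb F$ and some pairwise commuting $C_j\in\mathbb K^{n,n}$, $j=1,\ldots,k$. *)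

theory Defs
  imports "HOL-Analysis.Analysis"
begin

locale differential_field =
  fixes D :: "'a::field \<Rightarrow> 'a"
  assumes deriv_add: "D (a + b) = D a + D b"
    and deriv_mult: "D (a * b) = D a * b + a * D b"

definition constants :: "('a::field \<Rightarrow> 'a) \<Rightarrow> 'a set" where
  "constants D = {a. D a = 0}"

context differential_field
begin

lemma deriv_zero: "D 0 = 0"
  by (metis add_0_left add_cancel_right_right deriv_add)

lemma deriv_one: "D 1 = 0"
  by (metis add_cancel_right_right deriv_mult mult_1_left mult_1_right)

lemma deriv_minus: "D (- a) = - D a"
  using deriv_add[of a "- a"] by (simp add: deriv_zero eq_neg_iff_add_eq_0 add.commute)

lemma constants_subfield:
  "0 \<in> constants D" "1 \<in> constants D"
  "a \<in> constants D \<Longrightarrow> b \<in> constants D \<Longrightarrow> a + b \<in> constants D"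
  "a \<in> constants D \<Longrightarrow> - a \<in> constants D"
  "a \<in> constants D \<Longrightarrow> b \<in> constants D \<Longrightarrow> a * b \<in> constants D"
  "a \<in> constants D \<Longrightarrow> inverse a \<in> constants D"
proof -
  show "inverse a \<in> constants D" if "a \<in> constants D"
  proof (cases "a = 0")
    case False
    have "a * D (inverse a) = 0"
      using deriv_mult[of a "inverse a"] False that by (simp add: deriv_one constants_def)
    with False show ?thesis by (simp add: constants_def)
  qed (simp add: constants_def deriv_zero)
qed (simp_all add: constants_def deriv_zero deriv_one deriv_minus deriv_add deriv_mult)

end

definition matrix_deriv :: "('a \<Rightarrow> 'a) \<Rightarrow> 'a^'n^'m \<Rightarrow> 'a^'n^'m" where
  "matrix_deriv D M = (\<chi> i j. D (M $ i $ j))"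

definition matrix_over :: "'a set \<Rightarrow> 'a^'n^'m \<Rightarrow> bool" where
  "matrix_over H M \<longleftrightarrow> (\<forall>i j. M $ i $ j \<in> H)"

definition diagonal_matrix :: "'a::zero^'n^'n \<Rightarrow> bool" where
  "diagonal_matrix A \<longleftrightarrow> (\<forall>i j. i \<noteq> j \<longrightarrow> A $ i $ j = 0)"

text \<open>Meant for (the carrier of) a subfield \<open>H\<close>; the full field is \<open>UNIV\<close>.\<close>

definition diagonalizable_over :: "'a::field set \<Rightarrow> 'a^'n^'n \<Rightarrow> bool" where
  "diagonalizable_over H M \<longleftrightarrow>
     (\<exists>T :: 'a^'n^'n. matrix_over H T \<and> invertible T \<and> diagonal_matrix (matrix_inv T ** M ** T))"

text \<open>On \<open>'a^'n^'n\<close> the class operation \<open>*\<close> is componentwise, so scalar multiples of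
  matrices are written out and products use \<open>**\<close>.\<close>

definition is_type1 :: "('a::field \<Rightarrow> 'a) \<Rightarrow> 'a^'n^'n \<Rightarrow> bool" where
  "is_type1 D M \<longleftrightarrow>
     (\<exists>(k::nat) (f :: nat \<Rightarrow> 'a) (C :: nat \<Rightarrow> 'a^'n^'n).
        (\<forall>j\<in>{1..k}. matrix_over (constants D) (C j)) \<and>
        (\<forall>i\<in>{1..k}. \<forall>j\<in>{1..k}. C i ** C j = C j ** C i) \<and>
        M = (\<Sum>j=1..k. \<chi> p q. f j * C j $ p $ q))"

end

theory Submission
  imports Defs
begin

text \<open>Let \<open>P\<close> be a spectral projection of \<open>M\<close>. Any matrix commuting with \<open>M\<close> commutes with \<open>P\<close>,
  hence so does \<open>M'\<close>. Differentiating \<open>P M = M P\<close> then shows that \<open>P'\<close> commutes with \<open>M\<close>, and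
  therefore with \<open>P\<close>. An idempotent that commutes with its derivative is constant: \<open>P' = 2 P P'\<close>
  gives \<open>P P' = 2 P P'\<close>, so \<open>P P' = 0\<close> and \<open>P' = 0\<close>, in every characteristic. The spectral
  decomposition of \<open>M\<close> thus has constant commuting coefficients.\<close>

definition diag :: "('n \<Rightarrow> 'a::zero) \<Rightarrow> 'a^'n^'n" where
  "diag d = (\<chi> i j. if i = j then d i else 0)"

lemma matrix_mult_diag: "(A ** diag d) $ i $ j = A $ i $ j * d j"
  for A :: "'a::semiring_1^'n^'m"
  by (simp add: matrix_matrix_mult_def diag_def if_distrib cong: if_cong)

lemma diag_matrix_mult: "(diag d ** A) $ i $ j = d i * A $ i $ j"
  for A :: "'a::semiring_1^'m^'n"
  by (simp add: matrix_matrix_mult_def diag_def if_distrib[of "\<lambda>x. x * _"] cong: if_cong)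

lemma diag_mult_diag: "diag d ** diag e = diag (\<lambda>i. d i * e i)"
  for d e :: "'n::finite \<Rightarrow> 'a::semiring_1"
  by (simp add: vec_eq_iff diag_matrix_mult) (simp add: diag_def)

lemma diagonal_matrix_eq_diag:
  assumes "diagonal_matrix A"
  shows "A = diag (\<lambda>i. A $ i $ i)"
  using assms by (auto simp: vec_eq_iff diag_def diagonal_matrix_def)

text \<open>In an integral domain, commuting with \<open>diag d\<close> forces
  \<open>Y $ i $ j = 0\<close> unless \<open>d i = d j\<close>. On the remaining entries
  \<open>g (d i) = g (d j)\<close>, so the two products agree for an arbitrary function
  \<open>g\<close>; no polynomial interpolation of \<open>g\<close> is involved.\<close>

lemma commute_diag_comp:
  fixes Y :: "'a::idom^'n^'n"
  assumes "Y ** diag d = diag d ** Y"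
  shows "Y ** diag (\<lambda>i. g (d i)) = diag (\<lambda>i. g (d i)) ** Y"
proof -
  have "Y $ i $ j * d j = d i * Y $ i $ j" for i j
    using assms by (metis matrix_mult_diag diag_matrix_mult)
  then have "Y $ i $ j = 0 \<or> d i = d j" for i j
    by (metis mult.commute mult_cancel_right)
  then show ?thesis
    by (simp add: vec_eq_iff matrix_mult_diag diag_matrix_mult) (metis mult.commute mult_zero_left)
qed

lemma conjugate_mult:
  fixes S T :: "'a::semiring_1^'n^'n"
  assumes "S ** T = mat 1"
  shows "(T ** A ** S) ** (T ** B ** S) = T ** (A ** B) ** S"
  by (metis assms matrix_mul_assoc matrix_mul_lid)

text \<open>Transfers the diagonal case to a diagonalizable matrix. With \<open>g\<close> the
  indicator of one eigenvalue, it gives commutation with a spectral projection.\<close>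

lemma commute_conjugate_diag_comp:
  fixes X S T :: "'a::idom^'n^'n"
  assumes ST: "S ** T = mat 1" and TS: "T ** S = mat 1"
    and X: "X ** (T ** diag d ** S) = (T ** diag d ** S) ** X"
  shows "X ** (T ** diag (\<lambda>i. g (d i)) ** S) = (T ** diag (\<lambda>i. g (d i)) ** S) ** X"
proof -
  \<comment> \<open>\<open>Y\<close> is \<open>X\<close> written in the basis of eigenvectors formed
    by the columns of \<open>T\<close>.\<close>
  define Y where "Y = S ** X ** T"
  have X_eq: "X = T ** Y ** S"
    unfolding Y_def by (metis TS matrix_mul_assoc matrix_mul_lid matrix_mul_rid)
  have "T ** (Y ** diag d) ** S = T ** (diag d ** Y) ** S"
    using X unfolding X_eq conjugate_mult[OF ST] .
  then have "Y ** diag d = diag d ** Y"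
    by (metis ST matrix_mul_assoc matrix_mul_lid matrix_mul_rid)
  from commute_diag_comp[OF this, of g] show ?thesis
    unfolding X_eq conjugate_mult[OF ST] by simp
qed

text \<open>Each index \<open>i\<close> contributes to exactly one \<open>c\<close> in
  \<open>range d\<close>, namely \<open>c = d i\<close>; the sum over indices is grouped by the
  value of \<open>d\<close>.\<close>

lemma spectral_decomposition:
  fixes S T :: "'a::comm_ring_1^'n^'n"
  shows "T ** diag d ** S =
    (\<Sum>c\<in>range d. \<chi> p q. c * (T ** diag (\<lambda>i. of_bool (d i = c)) ** S) $ p $ q)"
proof -
  have entry: "(T ** diag e ** S) $ p $ q = (\<Sum>i\<in>UNIV. T $ p $ i * e i * S $ i $ q)"
    for p q and e :: "'n \<Rightarrow> 'a"
    by (simp add: matrix_matrix_mult_def[of "T ** diag e"] matrix_mult_diag)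
  have "(\<Sum>c\<in>range d. c * (T ** diag (\<lambda>i. of_bool (d i = c)) ** S) $ p $ q) =
    (T ** diag d ** S) $ p $ q" for p q
  proof -
    have "(\<Sum>c\<in>range d. c * (T ** diag (\<lambda>i. of_bool (d i = c)) ** S) $ p $ q) =
      (\<Sum>i\<in>UNIV. \<Sum>c\<in>range d. c * (T $ p $ i * of_bool (d i = c) * S $ i $ q))"
      unfolding entry sum_distrib_left by (rule sum.swap)
    also have "\<dots> = (\<Sum>i\<in>UNIV. \<Sum>c\<in>range d. if d i = c then T $ p $ i * c * S $ i $ q else 0)"
      by (intro sum.cong) auto
    also have "\<dots> = (T ** diag d ** S) $ p $ q"
      unfolding entry by (intro sum.cong) simp_all
    finally show ?thesis .
  qed
  then show ?thesis by (simp add: vec_eq_iff)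
qed

context differential_field
begin

lemma deriv_sum: "D (sum f A) = (\<Sum>x\<in>A. D (f x))"
  by (induction A rule: infinite_finite_induct) (simp_all add: deriv_zero deriv_add)

lemma matrix_deriv_mult:
  "matrix_deriv D (A ** B) = matrix_deriv D A ** B + A ** matrix_deriv D B"
  by (simp add: vec_eq_iff matrix_deriv_def matrix_matrix_mult_def deriv_sum deriv_mult
      sum.distrib)

lemma idempotent_matrix_deriv_eq_0:
  fixes P :: "'a^'n^'n"
  assumes idem: "P ** P = P"
    and comm: "matrix_deriv D P ** P = P ** matrix_deriv D P"
  shows "matrix_deriv D P = 0"
proof -
  define Q where "Q = matrix_deriv D P"
  have Q: "Q = P ** Q + P ** Q"
    using matrix_deriv_mult[of P P] comm idem by (simp add: Q_def)
  have "P ** Q = P ** (P ** Q + P ** Q)"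
    using Q by (rule arg_cong)
  also have "\<dots> = P ** Q + P ** Q"
    unfolding matrix_add_ldistrib matrix_mul_assoc idem by (rule refl)
  finally have "P ** Q = P ** Q + P ** Q" .
  then have "P ** Q = 0" by simp
  with Q show ?thesis by (simp add: Q_def)
qed

end

text \<open>Allows the sum to be indexed by the eigenvalues themselves; an enumeration of
  \<open>A\<close> supplies the numbering from 1.\<close>

lemma is_type1I:
  fixes C :: "'b \<Rightarrow> 'a::field^'n^'n"
  assumes "finite A"
    and const: "\<And>x. x \<in> A \<Longrightarrow> matrix_over (constants D) (C x)"
    and comm: "\<And>x y. x \<in> A \<Longrightarrow> y \<in> A \<Longrightarrow> C x ** C y = C y ** C x"
    and M: "M = (\<Sum>x\<in>A. \<chi> p q. f x * C x $ p $ q)"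
  shows "is_type1 D M"
proof -
  obtain h where h: "bij_betw h {1..card A} A"
    using ex_bij_betw_nat_finite_1[OF \<open>finite A\<close>] by blast
  have hA: "h j \<in> A" if "j \<in> {1..card A}" for j
    using h that by (rule bij_betwE[rule_format])
  have "M = (\<Sum>j=1..card A. \<chi> p q. f (h j) * C (h j) $ p $ q)"
    unfolding M by (rule sum.reindex_bij_betw[OF h, symmetric])
  with const comm hA show ?thesis
    unfolding is_type1_def
    by (intro exI[of _ "card A"] exI[of _ "\<lambda>j. f (h j)"] exI[of _ "\<lambda>j. C (h j)"]) blast
qed

theorem corollary11:
  fixes D :: "'a::field \<Rightarrow> 'a" and M :: "'a^'n^'n"
  assumes "differential_field D"
    and "M ** matrix_deriv D M = matrix_deriv D M ** M"
    and "diagonalizable_over UNIV M"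
  shows "is_type1 D M"
proof -
  interpret differential_field D by fact
  obtain T :: "'a^'n^'n" where T: "invertible T" and "diagonal_matrix (matrix_inv T ** M ** T)"
    using assms(3) unfolding diagonalizable_over_def by blast
  then obtain d where d: "matrix_inv T ** M ** T = diag d"
    using diagonal_matrix_eq_diag by blast
  define S where "S = matrix_inv T"
  \<comment> \<open>\<open>matrix_inv\<close> is a Hilbert choice, so invertibility of
    \<open>T\<close> yields both identities at once.\<close>
  have "T ** S = mat 1 \<and> S ** T = mat 1"
    using T unfolding S_def matrix_inv_def invertible_def by (rule someI_ex)
  then have ST: "S ** T = mat 1" and TS: "T ** S = mat 1" by simp_all
  have M: "M = T ** diag d ** S"
    unfolding d[symmetric] S_def[symmetric]
    by (metis TS matrix_mul_assoc matrix_mul_lid matrix_mul_rid)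
  \<comment> \<open>\<open>P c\<close> is the projection onto the eigenspace of \<open>c\<close>
    along the other eigenspaces, and is 0 when \<open>c\<close> is not an eigenvalue.\<close>
  define P where "P c = T ** diag (\<lambda>i. of_bool (d i = c)) ** S" for c
  have P_mult: "P a ** P b = (if a = b then P a else 0)" for a b
  proof -
    have "P a ** P b = T ** diag (\<lambda>i. of_bool (d i = a) * of_bool (d i = b)) ** S"
      by (simp add: P_def conjugate_mult[OF ST] diag_mult_diag)
    moreover have "(\<lambda>i. of_bool (d i = a) * of_bool (d i = b) :: 'a) =
      (if a = b then \<lambda>i. of_bool (d i = a) else (\<lambda>i. 0))"
      by auto
    moreover have "diag (\<lambda>i. 0) = (0 :: 'a^'n^'n)"
      by (simp add: vec_eq_iff diag_def)
    ultimately show ?thesis by (simp add: P_def)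
  qed
  have P_comm: "X ** P c = P c ** X" if "X ** M = M ** X" for X c
    using commute_conjugate_diag_comp[OF ST TS, of X d "\<lambda>x. of_bool (x = c)"] that
    by (simp add: M P_def)
  have P_const: "matrix_deriv D (P c) = 0" for c
  proof -
    have "matrix_deriv D M ** P c = P c ** matrix_deriv D M"
      using assms(2) by (intro P_comm) simp
    moreover have "matrix_deriv D (M ** P c) = matrix_deriv D (P c ** M)"
      using P_comm[of M c] by simp
    \<comment> \<open>After the product rule, the equal terms \<open>matrix_deriv D M ** P c\<close>
      and \<open>P c ** matrix_deriv D M\<close> cancel.\<close>
    ultimately have "matrix_deriv D (P c) ** M = M ** matrix_deriv D (P c)"
      unfolding matrix_deriv_mult by (simp add: add.commute)
    from P_comm[OF this] show ?thesis
      by (intro idempotent_matrix_deriv_eq_0) (simp_all add: P_mult)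
  qed
  show ?thesis
  proof (rule is_type1I)
    \<comment> \<open>The index \<open>c\<close> is its own coefficient: the functions in the Type 1
      form are the distinct eigenvalues of \<open>M\<close>.\<close>
    show "M = (\<Sum>c\<in>range d. \<chi> p q. c * P c $ p $ q)"
      unfolding M P_def by (rule spectral_decomposition)
    show "matrix_over (constants D) (P c)" for c
      using P_const[of c] by (simp add: vec_eq_iff matrix_deriv_def matrix_over_def constants_def)
    show "P a ** P b = P b ** P a" for a b
      by (simp add: P_mult)
  qed simp
qed

end
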